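(* For any three free linkages $\mathcal{F}_1,\mathcal{F}_2,\mathcal{F}_3$ in the plane, the moduli space $M(\mathcal{F}_1,\mathcal{F}_2,\mathcal{F}_3)$ is a compact, Hausdorff, real algebraic variety.
   Context: A free linkage $\mathcal{F}$ in $\mathbb{R}^2$ with length vector $\mathbf{d}=(d_1,\ldots,d_n)$, $d_i>0$, has configurations $(x_1,\ldots,x_{n+1})\in(\mathbb{R}^2)^{n+1}$ with $|x_i-x_{i+1}|=d_i$ for $i=1,\ldots,n$; $x_1$ is the initial vertex and $x_{n+1}$ the terminal vertex. For free linkages $\mathcal{F}_1,\mathcal{F}_2,\mathcal{F}_3$, $C(\mathcal{F}_1,\mathcal{F}_2,\mathcal{F}_3)$ is the space of triples of configurations of $\mathcal{F}_1,\mathcal{F}_2,\mathcal{F}_3$ such that all three initial vertices are at the origin and all three terminal vertices coincide. The moduli space is $M(\mathcal{F}_1,\mathcal{F}_2,\mathcal{F}_3)=C(\mathcal{F}_1,\mathcal{F}_2,\mathcal{F}_3)/SO(2)$. It is identified with the subspace of $C(\mathcal{F}_1,\mathcal{F}_2,\mathcal{F}_3)$ consisting of those triples in which the first edge of $\mathcal{F}_1$ (from its first to its second vertex) lies on the positive $x$-axis. *)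

theory Defs
  imports "HOL-Analysis.Analysis"
begin

section \<open>Quotient topology\<close>

definition quotient_topology :: "'a topology \<Rightarrow> ('a \<Rightarrow> 'b) \<Rightarrow> 'b topology" where
  "quotient_topology X f =
     topology (\<lambda>U. U \<subseteq> f ` topspace X \<and> openin X {x \<in> topspace X. f x \<in> U})"

lemma openin_quotient_topology:
  "openin (quotient_topology X f) U \<longleftrightarrow>
     U \<subseteq> f ` topspace X \<and> openin X {x \<in> topspace X. f x \<in> U}"
proof -
  have "istopology (\<lambda>U. U \<subseteq> f ` topspace X \<and> openin X {x \<in> topspace X. f x \<in> U})"
    unfolding istopology_def
  proof (intro conjI allI impI)
    fix S T
    assume S: "S \<subseteq> f ` topspace X \<and> openin X {x \<in> topspace X. f x \<in> S}"
      and T: "T \<subseteq> f ` topspace X \<and> openin X {x \<in> topspace X. f x \<in> T}"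
    show "S \<inter> T \<subseteq> f ` topspace X" using S by blast
    have "{x \<in> topspace X. f x \<in> S \<inter> T} =
        {x \<in> topspace X. f x \<in> S} \<inter> {x \<in> topspace X. f x \<in> T}" by blast
    then show "openin X {x \<in> topspace X. f x \<in> S \<inter> T}" using S T by auto
  next
    fix K
    assume K: "\<forall>S\<in>K. S \<subseteq> f ` topspace X \<and> openin X {x \<in> topspace X. f x \<in> S}"
    show "\<Union>K \<subseteq> f ` topspace X" using K by blast
    have "{x \<in> topspace X. f x \<in> \<Union>K} = (\<Union>S\<in>K. {x \<in> topspace X. f x \<in> S})" by blast
    then show "openin X {x \<in> topspace X. f x \<in> \<Union>K}" using K by auto
  qed
  then show ?thesis
    unfolding quotient_topology_def by (simp add: topology_inverse')
qed

lemma topspace_quotient_topology: "topspace (quotient_topology X f) = f ` topspace X"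
proof -
  have "{x \<in> topspace X. f x \<in> f ` topspace X} = topspace X" by blast
  then have "openin (quotient_topology X f) (f ` topspace X)"
    by (simp add: openin_quotient_topology)
  moreover have "topspace (quotient_topology X f) \<subseteq> f ` topspace X"
    using openin_topspace[of "quotient_topology X f"] by (simp only: openin_quotient_topology)
  ultimately show ?thesis by (intro subset_antisym openin_subset)
qed

lemma quotient_map_quotient_topology: "quotient_map X (quotient_topology X f) f"
  unfolding quotient_map_def topspace_quotient_topology openin_quotient_topology by simp


section \<open>Real algebraic varieties\<close>

text \<open>The points of the affine space with coordinates indexed by \<open>V\<close> are the functions in
  \<^term>\<open>V \<rightarrow>\<^sub>E (UNIV :: real set)\<close>, as in \<^const>\<open>product_topology\<close>. The library's
  \<open>real_polynomial_function\<close> needs a normed vector space as its domain, so it does not apply.\<close>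

inductive polynomial_in :: "'v set \<Rightarrow> (('v \<Rightarrow> real) \<Rightarrow> real) \<Rightarrow> bool" for V where
  coordinate: "v \<in> V \<Longrightarrow> polynomial_in V (\<lambda>x. x v)"
| const: "polynomial_in V (\<lambda>x. c)"
| add: "\<lbrakk>polynomial_in V p; polynomial_in V q\<rbrakk> \<Longrightarrow> polynomial_in V (\<lambda>x. p x + q x)"
| mult: "\<lbrakk>polynomial_in V p; polynomial_in V q\<rbrakk> \<Longrightarrow> polynomial_in V (\<lambda>x. p x * q x)"

definition real_algebraic_set :: "'v set \<Rightarrow> ('v \<Rightarrow> real) set \<Rightarrow> bool" where
  "real_algebraic_set V S \<longleftrightarrow> finite V \<and>
     (\<exists>P. finite P \<and> (\<forall>p\<in>P. polynomial_in V p) \<and>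
          S = {x \<in> V \<rightarrow>\<^sub>E UNIV. \<forall>p\<in>P. p x = 0})"

text \<open>A space \<open>X\<close> is a real algebraic variety with respect to coordinates \<open>\<phi>\<close> if \<open>\<phi>\<close> embeds it
  topologically as an algebraic subset of affine space. Irreducibility is not required.\<close>

definition real_algebraic_variety :: "'v set \<Rightarrow> 'a topology \<Rightarrow> ('a \<Rightarrow> 'v \<Rightarrow> real) \<Rightarrow> bool" where
  "real_algebraic_variety V X \<phi> \<longleftrightarrow>
     real_algebraic_set V (\<phi> ` topspace X) \<and>
     homeomorphic_map X (subtopology (powertop_real V) (\<phi> ` topspace X)) \<phi>"


section \<open>Free linkages in the plane\<close>

text \<open>A free linkage is given by its list of edge lengths; its vertices are numbered
  \<open>0, \<dots>, length d\<close>, and edge \<open>i\<close> joins vertices \<open>i\<close> and \<open>i + 1\<close>.\<close>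

definition free_linkage :: "real list \<Rightarrow> bool" where
  "free_linkage d \<longleftrightarrow> d \<noteq> [] \<and> (\<forall>i<length d. d ! i > 0)"

abbreviation vertices :: "real list \<Rightarrow> nat set" where
  "vertices d \<equiv> {..length d}"

type_synonym config = "nat \<Rightarrow> real^2"

definition configurations :: "real list \<Rightarrow> config set" where
  "configurations d =
     {x \<in> vertices d \<rightarrow>\<^sub>E UNIV. \<forall>i<length d. dist (x i) (x (Suc i)) = d ! i}"

definition config_triples ::
    "real list \<Rightarrow> real list \<Rightarrow> real list \<Rightarrow> (config \<times> config \<times> config) set" where
  "config_triples F1 F2 F3 =
     {(x, y, z). x \<in> configurations F1 \<and> y \<in> configurations F2 \<and> z \<in> configurations F3 \<and>
        x 0 = 0 \<and> y 0 = 0 \<and> z 0 = 0 \<and>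
        x (length F1) = y (length F2) \<and> y (length F2) = z (length F3)}"

definition config_space ::
    "real list \<Rightarrow> real list \<Rightarrow> real list \<Rightarrow> (config \<times> config \<times> config) topology" where
  "config_space F1 F2 F3 =
     subtopology
       (prod_topology (product_topology (\<lambda>_. euclidean) (vertices F1))
         (prod_topology (product_topology (\<lambda>_. euclidean) (vertices F2))
           (product_topology (\<lambda>_. euclidean) (vertices F3))))
       (config_triples F1 F2 F3)"


section \<open>The moduli space\<close>

definition SO2 :: "(real^2^2) set" where
  "SO2 = {A. rotation_matrix A}"

definition rotate_triple :: "real list \<Rightarrow> real list \<Rightarrow> real list \<Rightarrow> real^2^2
    \<Rightarrow> config \<times> config \<times> config \<Rightarrow> config \<times> config \<times> config" where
  "rotate_triple F1 F2 F3 A = (\<lambda>(x, y, z).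
     (\<lambda>i\<in>vertices F1. A *v x i, \<lambda>i\<in>vertices F2. A *v y i, \<lambda>i\<in>vertices F3. A *v z i))"

definition SO2_orbit :: "real list \<Rightarrow> real list \<Rightarrow> real list
    \<Rightarrow> config \<times> config \<times> config \<Rightarrow> (config \<times> config \<times> config) set" where
  "SO2_orbit F1 F2 F3 t = (\<lambda>A. rotate_triple F1 F2 F3 A t) ` SO2"

definition moduli_space ::
    "real list \<Rightarrow> real list \<Rightarrow> real list \<Rightarrow> (config \<times> config \<times> config) set topology" where
  "moduli_space F1 F2 F3 = quotient_topology (config_space F1 F2 F3) (SO2_orbit F1 F2 F3)"

text \<open>The triples in which the first edge of the first linkage, which starts at the origin,
  lies on the positive \<open>x\<close>-axis.\<close>

definition normalized_space ::
    "real list \<Rightarrow> real list \<Rightarrow> real list \<Rightarrow> (config \<times> config \<times> config) topology" where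
  "normalized_space F1 F2 F3 =
     subtopology (config_space F1 F2 F3) {(x, y, z). x 1 $ 1 > 0 \<and> x 1 $ 2 = 0}"

text \<open>One real coordinate for each linkage (the summand of the sum type), vertex and axis.\<close>

type_synonym coord_index = "(nat \<times> 2) + (nat \<times> 2) + (nat \<times> 2)"

definition coord_indices :: "real list \<Rightarrow> real list \<Rightarrow> real list \<Rightarrow> coord_index set" where
  "coord_indices F1 F2 F3 =
     (vertices F1 \<times> UNIV) <+> (vertices F2 \<times> UNIV) <+> (vertices F3 \<times> UNIV)"

definition vertex_coords :: "real list \<Rightarrow> real list \<Rightarrow> real list
    \<Rightarrow> config \<times> config \<times> config \<Rightarrow> coord_index \<Rightarrow> real" where
  "vertex_coords F1 F2 F3 = (\<lambda>(x, y, z). restrict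
     (case_sum (\<lambda>(i, c). x i $ c) (case_sum (\<lambda>(i, c). y i $ c) (\<lambda>(i, c). z i $ c)))
     (coord_indices F1 F2 F3))"

end

theory Submission
  imports Defs
begin

text \<open>Everything rests on the slice of normalized triples, those whose first edge of the first
  linkage points along the positive \<open>x\<close>-axis.

  The slice is algebraic. In vertex coordinates, prescribing the length \<open>d\<close> of an edge is the
  quadratic equation saying that the squared distance is \<open>d\<^sup>2\<close> (this loses nothing because
  \<open>d > 0\<close>), while base points and coinciding end points give linear equations. The condition of
  lying on the positive axis contains a strict inequality, but it becomes two linear equations:
  the first vertex after the base point is at a known distance \<open>d\<close> from the origin, so the
  condition says that it equals \<open>(d, 0)\<close>. Algebraic sets are closed, and every vertex of a chain
  that starts at the origin is within the total length of the chain. Thus the slice is closed and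
  bounded in a finite-dimensional affine space (\<open>real_algebraic_set_normalized\<close>,
  \<open>compact_Hausdorff_normalized_space\<close>).

  The slice is homeomorphic to the moduli space (\<open>homeomorphic_map_SO2_orbit\<close>). Dividing the
  coordinates of the first edge by its constant length gives, up to sign, the entries of the rotation that
  takes this edge to the positive axis, so the normalizing rotation depends continuously on the
  triple. A rotation that fixes a point of the positive axis is the identity, hence each orbit
  meets the slice exactly once. Normalization is therefore a continuous retraction onto the slice
  that is constant on orbits; it descends to the quotient, and there it is inverse to the orbit
  map. Compactness and the Hausdorff property then pass from the slice to the moduli space.\<close>

section \<open>Real algebraic sets in coordinate space\<close>

lemma polynomial_in_diff:
  assumes "polynomial_in V p" and "polynomial_in V q"
  shows "polynomial_in V (\<lambda>x. p x - q x)"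
proof -
  have "polynomial_in V (\<lambda>x. p x + (- 1) * q x)"
    using assms by (intro polynomial_in.intros)
  then show ?thesis by simp
qed

lemma polynomial_in_power2: "polynomial_in V p \<Longrightarrow> polynomial_in V (\<lambda>x. (p x)\<^sup>2)"
  unfolding power2_eq_square by (intro polynomial_in.mult)

lemma continuous_map_polynomial_in:
  "polynomial_in V p \<Longrightarrow> continuous_map (powertop_real V) euclideanreal p"
proof (induction rule: polynomial_in.induct)
  case (coordinate v)
  then show ?case by (rule continuous_map_product_projection)
qed (auto intro: continuous_map_add continuous_map_real_mult)

lemma real_algebraic_set_zeros:
  assumes "finite V" and "finite I" and "\<And>i. i \<in> I \<Longrightarrow> polynomial_in V (p i)"
  shows "real_algebraic_set V {x \<in> V \<rightarrow>\<^sub>E UNIV. \<forall>i\<in>I. p i x = 0}"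
  unfolding real_algebraic_set_def using assms by (intro conjI exI[of _ "p ` I"]) auto

lemma real_algebraic_set_Int:
  assumes "real_algebraic_set V S" and "real_algebraic_set V T"
  shows "real_algebraic_set V (S \<inter> T)"
proof -
  obtain P where P: "finite P" "\<forall>p\<in>P. polynomial_in V p"
      "S = {x \<in> V \<rightarrow>\<^sub>E UNIV. \<forall>p\<in>P. p x = 0}"
    using assms(1) unfolding real_algebraic_set_def by blast
  obtain Q where Q: "finite Q" "\<forall>p\<in>Q. polynomial_in V p"
      "T = {x \<in> V \<rightarrow>\<^sub>E UNIV. \<forall>p\<in>Q. p x = 0}"
    using assms(2) unfolding real_algebraic_set_def by blast
  have "S \<inter> T = {x \<in> V \<rightarrow>\<^sub>E UNIV. \<forall>p\<in>P \<union> Q. p x = 0}"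
    unfolding P(3) Q(3) by blast
  then show ?thesis
    using assms(1) P(1,2) Q(1,2) unfolding real_algebraic_set_def
    by (intro conjI exI[of _ "P \<union> Q"]) auto
qed

text \<open>The zero set of each polynomial is the preimage of the closed set \<open>{0}\<close> under a continuous
  function. The whole space is added to the intersection to cover an empty set of equations.\<close>

lemma closedin_real_algebraic_set:
  assumes "real_algebraic_set V S"
  shows "closedin (powertop_real V) S"
proof -
  obtain P where P: "finite P" "\<forall>p\<in>P. polynomial_in V p"
      "S = {x \<in> V \<rightarrow>\<^sub>E UNIV. \<forall>p\<in>P. p x = 0}"
    using assms unfolding real_algebraic_set_def by blast
  let ?Z = "\<lambda>p. {x \<in> topspace (powertop_real V). p x \<in> {0}}"
  have Z: "closedin (powertop_real V) (?Z p)" if "p \<in> P" for p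
    using that P(2)
    by (intro closedin_continuous_map_preimage[OF continuous_map_polynomial_in]) auto
  have "S = \<Inter>(insert (topspace (powertop_real V)) (?Z ` P))"
    unfolding P(3) by auto
  moreover have "closedin (powertop_real V) (\<Inter>(insert (topspace (powertop_real V)) (?Z ` P)))"
  proof (rule closedin_Inter)
    fix K assume "K \<in> insert (topspace (powertop_real V)) (?Z ` P)"
    then consider "K = topspace (powertop_real V)" | p where "p \<in> P" "K = ?Z p"
      by blast
    then show "closedin (powertop_real V) K"
      by cases (simp_all only: closedin_topspace Z)
  qed simp
  ultimately show ?thesis by simp
qed

text \<open>Heine--Borel in coordinate space: a box is compact by Tychonoff's theorem, and an algebraic
  set is closed in it.\<close>

lemma compactin_real_algebraic_set:
  assumes "real_algebraic_set V S" and "\<And>x v. x \<in> S \<Longrightarrow> v \<in> V \<Longrightarrow> \<bar>x v\<bar> \<le> R"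
  shows "compactin (powertop_real V) S"
proof (rule closed_compactin)
  show "compactin (powertop_real V) (V \<rightarrow>\<^sub>E {-R..R})"
    by (simp add: compactin_PiE)
  show "closedin (powertop_real V) S"
    using assms(1) by (rule closedin_real_algebraic_set)
  show "S \<subseteq> V \<rightarrow>\<^sub>E {-R..R}"
  proof
    fix x assume x: "x \<in> S"
    have "x \<in> V \<rightarrow>\<^sub>E UNIV"
      using x assms(1) by (auto simp: real_algebraic_set_def)
    moreover have "x v \<in> {-R..R}" if "v \<in> V" for v
      using assms(2)[OF x that] by (simp add: abs_le_iff)
    ultimately show "x \<in> V \<rightarrow>\<^sub>E {-R..R}"
      by (simp add: PiE_iff)
  qed
qed

section \<open>Vertex coordinates\<close>

abbreviation triple_space ::
    "real list \<Rightarrow> real list \<Rightarrow> real list \<Rightarrow> (config \<times> config \<times> config) topology" where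
  "triple_space F1 F2 F3 \<equiv>
     prod_topology (product_topology (\<lambda>_. euclidean) (vertices F1))
       (prod_topology (product_topology (\<lambda>_. euclidean) (vertices F2))
         (product_topology (\<lambda>_. euclidean) (vertices F3)))"

text \<open>The injection \<open>\<iota>\<close> selects the block of coordinates that belongs to one of the three linkages,
  so that the equations of a single linkage need to be written only once.\<close>

definition vertex_at :: "(nat \<times> 2 \<Rightarrow> 'v) \<Rightarrow> ('v \<Rightarrow> real) \<Rightarrow> nat \<Rightarrow> real^2" where
  "vertex_at \<iota> g i = (\<chi> c. g (\<iota> (i, c)))"

definition triple_of_coords ::
    "real list \<Rightarrow> real list \<Rightarrow> real list \<Rightarrow> (coord_index \<Rightarrow> real) \<Rightarrow> config \<times> config \<times> config" where
  "triple_of_coords F1 F2 F3 g =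
     (\<lambda>i\<in>vertices F1. vertex_at Inl g i,
      \<lambda>i\<in>vertices F2. vertex_at (Inr \<circ> Inl) g i,
      \<lambda>i\<in>vertices F3. vertex_at (Inr \<circ> Inr) g i)"

lemma finite_coord_indices: "finite (coord_indices F1 F2 F3)"
  by (simp add: coord_indices_def)

lemma coord_indices_cases:
  assumes "k \<in> coord_indices F1 F2 F3"
  obtains (first) i c where "k = Inl (i, c)" "i \<in> vertices F1"
    | (second) i c where "k = Inr (Inl (i, c))" "i \<in> vertices F2"
    | (third) i c where "k = Inr (Inr (i, c))" "i \<in> vertices F3"
  using assms unfolding coord_indices_def by auto

lemma Inl_in_coord_indices: "Inl (i, c) \<in> coord_indices F1 F2 F3 \<longleftrightarrow> i \<in> vertices F1"
  and InrInl_in_coord_indices: "Inr (Inl (i, c)) \<in> coord_indices F1 F2 F3 \<longleftrightarrow> i \<in> vertices F2"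
  and InrInr_in_coord_indices: "Inr (Inr (i, c)) \<in> coord_indices F1 F2 F3 \<longleftrightarrow> i \<in> vertices F3"
  by (auto simp: coord_indices_def)

lemmas in_coord_indices = Inl_in_coord_indices InrInl_in_coord_indices InrInr_in_coord_indices

lemma vertex_coords_apply:
  "i \<in> vertices F1 \<Longrightarrow> vertex_coords F1 F2 F3 t (Inl (i, c)) = fst t i $ c"
  "i \<in> vertices F2 \<Longrightarrow> vertex_coords F1 F2 F3 t (Inr (Inl (i, c))) = fst (snd t) i $ c"
  "i \<in> vertices F3 \<Longrightarrow> vertex_coords F1 F2 F3 t (Inr (Inr (i, c))) = snd (snd t) i $ c"
  by (cases t; simp add: vertex_coords_def in_coord_indices)+

text \<open>This reduces continuity into the plane to real-valued functions, where it is preserved by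
  sums and products over arbitrary topological spaces.\<close>

lemma continuous_map_vec:
  fixes f :: "'a \<Rightarrow> real^'n"
  shows "continuous_map X euclidean f \<longleftrightarrow> (\<forall>c. continuous_map X euclideanreal (\<lambda>t. f t $ c))"
  by (auto simp: continuous_map_atin intro: vec_tendstoI tendsto_vec_nth)

lemma continuous_map_vertex:
  shows "i \<in> vertices F1 \<Longrightarrow> continuous_map (triple_space F1 F2 F3) euclidean (\<lambda>t. fst t i)"
    and "i \<in> vertices F2 \<Longrightarrow> continuous_map (triple_space F1 F2 F3) euclidean (\<lambda>t. fst (snd t) i)"
    and "i \<in> vertices F3 \<Longrightarrow> continuous_map (triple_space F1 F2 F3) euclidean (\<lambda>t. snd (snd t) i)"
proof -
  have comp: "continuous_map (triple_space F1 F2 F3) euclidean (\<lambda>t. g t i)"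
    if "continuous_map (triple_space F1 F2 F3) (product_topology (\<lambda>_. euclidean) (vertices F)) g"
      and "i \<in> vertices F" for g :: "config \<times> config \<times> config \<Rightarrow> config" and F
    using continuous_map_compose[OF that(1) continuous_map_product_projection[OF that(2)]]
    by (simp add: o_def)
  note snd_comp = continuous_map_compose[OF continuous_map_snd, unfolded o_def]
  show "i \<in> vertices F1 \<Longrightarrow> continuous_map (triple_space F1 F2 F3) euclidean (\<lambda>t. fst t i)"
    using comp[OF continuous_map_fst] .
  show "i \<in> vertices F2 \<Longrightarrow> continuous_map (triple_space F1 F2 F3) euclidean (\<lambda>t. fst (snd t) i)"
    using comp[OF snd_comp[OF continuous_map_fst]] .
  show "i \<in> vertices F3 \<Longrightarrow> continuous_map (triple_space F1 F2 F3) euclidean (\<lambda>t. snd (snd t) i)"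
    using comp[OF snd_comp[OF continuous_map_snd]] .
qed

lemma continuous_map_into_triple_space:
  "continuous_map X (triple_space F1 F2 F3) (\<lambda>t. (\<lambda>i\<in>vertices F1. f t i,
      \<lambda>i\<in>vertices F2. g t i, \<lambda>i\<in>vertices F3. h t i)) \<longleftrightarrow>
    (\<forall>i\<in>vertices F1. \<forall>c. continuous_map X euclideanreal (\<lambda>t. f t i $ c)) \<and>
    (\<forall>i\<in>vertices F2. \<forall>c. continuous_map X euclideanreal (\<lambda>t. g t i $ c)) \<and>
    (\<forall>i\<in>vertices F3. \<forall>c. continuous_map X euclideanreal (\<lambda>t. h t i $ c))"
  by (simp add: continuous_map_pairwise o_def continuous_map_componentwise continuous_map_vec
      image_subset_iff)

text \<open>Coordinates are taken on the space of all triples of vertex sequences, where the inverse is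
  defined everywhere. The statements about the normalized triples then follow by restriction.\<close>

lemma homeomorphic_maps_vertex_coords:
  "homeomorphic_maps (triple_space F1 F2 F3) (powertop_real (coord_indices F1 F2 F3))
     (vertex_coords F1 F2 F3) (triple_of_coords F1 F2 F3)"
  unfolding homeomorphic_maps_def
proof (intro conjI ballI)
  show "continuous_map (triple_space F1 F2 F3) (powertop_real (coord_indices F1 F2 F3))
          (vertex_coords F1 F2 F3)"
    unfolding continuous_map_componentwise
  proof (intro conjI ballI)
    show "vertex_coords F1 F2 F3 ` topspace (triple_space F1 F2 F3)
            \<subseteq> extensional (coord_indices F1 F2 F3)"
      by (auto simp: vertex_coords_def)
    fix k assume "k \<in> coord_indices F1 F2 F3"
    then show "continuous_map (triple_space F1 F2 F3) euclideanreal
                 (\<lambda>t. vertex_coords F1 F2 F3 t k)"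
      by (cases rule: coord_indices_cases)
        (simp_all add: vertex_coords_apply continuous_map_vertex[unfolded continuous_map_vec])
  qed
  show "continuous_map (powertop_real (coord_indices F1 F2 F3)) (triple_space F1 F2 F3)
          (triple_of_coords F1 F2 F3)"
    unfolding triple_of_coords_def continuous_map_into_triple_space
    by (auto simp: vertex_at_def in_coord_indices intro!: continuous_map_product_projection)
next
  fix t assume "t \<in> topspace (triple_space F1 F2 F3)"
  then show "triple_of_coords F1 F2 F3 (vertex_coords F1 F2 F3 t) = t"
    by (cases t) (auto simp: triple_of_coords_def vertex_at_def vertex_coords_apply PiE_iff
        extensional_def vec_eq_iff fun_eq_iff)
next
  fix g assume g: "g \<in> topspace (powertop_real (coord_indices F1 F2 F3))"
  show "vertex_coords F1 F2 F3 (triple_of_coords F1 F2 F3 g) = g"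
  proof
    fix k
    show "vertex_coords F1 F2 F3 (triple_of_coords F1 F2 F3 g) k = g k"
    proof (cases "k \<in> coord_indices F1 F2 F3")
      case True
      then show ?thesis
        by (cases rule: coord_indices_cases)
          (simp_all add: vertex_coords_apply triple_of_coords_def vertex_at_def)
    next
      case False
      then show ?thesis
        using g by (simp add: vertex_coords_def triple_of_coords_def PiE_iff extensional_def)
    qed
  qed
qed

section \<open>The normalized triples form a compact algebraic set\<close>

text \<open>Positivity of \<open>d\<close> makes it possible to square both sides without adding solutions.\<close>

lemma vertex_dist_eq_iff:
  assumes "d > 0"
  shows "dist (vertex_at \<iota> g i) (vertex_at \<kappa> g j) = d \<longleftrightarrow>
    (g (\<iota> (i, 1)) - g (\<kappa> (j, 1)))\<^sup>2 + (g (\<iota> (i, 2)) - g (\<kappa> (j, 2)))\<^sup>2 - d\<^sup>2 = 0"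
  using assms real_sqrt_unique[of d]
  by (auto simp: vertex_at_def dist_norm norm_vec_def L2_set_def sum_2)

lemma real_algebraic_set_edge_lengths:
  assumes "finite V" and "free_linkage d" and "\<And>i c. i \<in> vertices d \<Longrightarrow> \<iota> (i, c) \<in> V"
  shows "real_algebraic_set V {g \<in> V \<rightarrow>\<^sub>E UNIV.
    \<forall>i<length d. dist (vertex_at \<iota> g i) (vertex_at \<iota> g (Suc i)) = d ! i}"
proof -
  let ?p = "\<lambda>i g. (g (\<iota> (i, 1)) - g (\<iota> (Suc i, 1)))\<^sup>2 +
    (g (\<iota> (i, 2)) - g (\<iota> (Suc i, 2)))\<^sup>2 - (d ! i)\<^sup>2"
  have "real_algebraic_set V {g \<in> V \<rightarrow>\<^sub>E UNIV. \<forall>i\<in>{..<length d}. ?p i g = 0}"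
    using assms(1,3)
    by (intro real_algebraic_set_zeros polynomial_in_diff polynomial_in.add polynomial_in_power2
        polynomial_in.const polynomial_in.coordinate) auto
  then show ?thesis
    using assms(2) by (simp add: vertex_dist_eq_iff free_linkage_def lessThan_def cong: conj_cong)
qed

lemma real_algebraic_set_vertex_eq:
  assumes "finite V" and "\<And>c. \<iota> (i, c) \<in> V" and "\<And>c. \<kappa> (j, c) \<in> V"
  shows "real_algebraic_set V {g \<in> V \<rightarrow>\<^sub>E UNIV. vertex_at \<iota> g i = vertex_at \<kappa> g j}"
  using real_algebraic_set_zeros[of V UNIV "\<lambda>c g. g (\<iota> (i, c)) - g (\<kappa> (j, c))"] assms
  by (simp add: polynomial_in_diff polynomial_in.intros vertex_at_def vec_eq_iff)

lemma real_algebraic_set_vertex_eq_const: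
  assumes "finite V" and "\<And>c. \<iota> (i, c) \<in> V"
  shows "real_algebraic_set V {g \<in> V \<rightarrow>\<^sub>E UNIV. vertex_at \<iota> g i = p}"
  using real_algebraic_set_zeros[of V UNIV "\<lambda>c g. g (\<iota> (i, c)) - p $ c"] assms
  by (simp add: polynomial_in_diff polynomial_in.intros vertex_at_def vec_eq_iff)

lemma norm_first_vertex:
  assumes "free_linkage d" and "x \<in> configurations d" and "x 0 = 0"
  shows "norm (x 1) = d ! 0" and "d ! 0 > 0"
  using assms by (auto simp: configurations_def free_linkage_def dist_norm dest: spec[of _ 0])

text \<open>A point at known distance from the origin lies on the positive axis exactly when two linear
  equations hold; this removes the inequality from the description of normalized triples.\<close>

lemma positive_x_axis_iff:
  fixes p :: "real^2"
  assumes "norm p = d" and "d > 0"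
  shows "p $ 1 > 0 \<and> p $ 2 = 0 \<longleftrightarrow> p = vector [d, 0]"
  using assms by (auto simp: vec_eq_iff forall_2 norm_vec_def L2_set_def sum_2)

lemma topspace_config_space: "topspace (config_space F1 F2 F3) = config_triples F1 F2 F3"
  unfolding config_space_def
  by (auto simp: topspace_subtopology config_triples_def configurations_def)

text \<open>Normalized triples carry the topology of the space of all triples, where the vertex
  coordinates are a homeomorphism.\<close>

lemma normalized_space_eq:
  "normalized_space F1 F2 F3 =
     subtopology (triple_space F1 F2 F3) (topspace (normalized_space F1 F2 F3))"
  unfolding normalized_space_def config_space_def subtopology_subtopology topspace_subtopology
    subtopology_restrict ..

lemma topspace_normalized_space:
  assumes "free_linkage F1"
  shows "topspace (normalized_space F1 F2 F3) =
    {t \<in> config_triples F1 F2 F3. fst t 1 = vector [F1 ! 0, 0]}"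
proof -
  have "fst t 1 $ 1 > 0 \<and> fst t 1 $ 2 = 0 \<longleftrightarrow> fst t 1 = vector [F1 ! 0, 0]"
    if "t \<in> config_triples F1 F2 F3" for t
  proof (rule positive_x_axis_iff)
    have "fst t \<in> configurations F1" "fst t 0 = 0"
      using that by (auto simp: config_triples_def)
    then show "norm (fst t 1) = F1 ! 0" "F1 ! 0 > 0"
      using norm_first_vertex[OF assms] by blast+
  qed
  moreover have "{(x :: config, y :: config, z :: config). x 1 $ 1 > 0 \<and> x 1 $ 2 = 0} =
      {t. fst t 1 $ 1 > 0 \<and> fst t 1 $ 2 = 0}"
    by auto
  ultimately show ?thesis
    unfolding normalized_space_def topspace_subtopology topspace_config_space by auto
qed

lemma restrict_in_configurations_iff:
  "restrict f (vertices d) \<in> configurations d \<longleftrightarrow> (\<forall>i<length d. dist (f i) (f (Suc i)) = d ! i)"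
  by (auto simp: configurations_def)

lemma triple_of_coords_in_config_triples_iff:
  "triple_of_coords F1 F2 F3 g \<in> config_triples F1 F2 F3 \<longleftrightarrow>
    (\<forall>i<length F1. dist (vertex_at Inl g i) (vertex_at Inl g (Suc i)) = F1 ! i) \<and>
    (\<forall>i<length F2. dist (vertex_at (Inr \<circ> Inl) g i) (vertex_at (Inr \<circ> Inl) g (Suc i)) = F2 ! i) \<and>
    (\<forall>i<length F3. dist (vertex_at (Inr \<circ> Inr) g i) (vertex_at (Inr \<circ> Inr) g (Suc i)) = F3 ! i) \<and>
    vertex_at Inl g 0 = 0 \<and> vertex_at (Inr \<circ> Inl) g 0 = 0 \<and> vertex_at (Inr \<circ> Inr) g 0 = 0 \<and>
    vertex_at Inl g (length F1) = vertex_at (Inr \<circ> Inl) g (length F2) \<and>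
    vertex_at (Inr \<circ> Inl) g (length F2) = vertex_at (Inr \<circ> Inr) g (length F3)"
  by (simp add: triple_of_coords_def config_triples_def restrict_in_configurations_iff)

text \<open>Since the coordinates are a bijection with an explicit inverse, an image of a set of triples
  is described by a condition on the triple recovered from the coordinates; this is the form in
  which polynomial equations can be read off.\<close>

lemma vertex_coords_image:
  assumes "T \<subseteq> topspace (triple_space F1 F2 F3)"
  shows "vertex_coords F1 F2 F3 ` T =
    {g \<in> coord_indices F1 F2 F3 \<rightarrow>\<^sub>E UNIV. triple_of_coords F1 F2 F3 g \<in> T}" (is "_ = ?R")
proof
  have hom: "vertex_coords F1 F2 F3 t \<in> coord_indices F1 F2 F3 \<rightarrow>\<^sub>E UNIV"
    "triple_of_coords F1 F2 F3 (vertex_coords F1 F2 F3 t) = t"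
    if "t \<in> topspace (triple_space F1 F2 F3)" for t
    using that homeomorphic_maps_vertex_coords[of F1 F2 F3]
    unfolding homeomorphic_maps_def by (auto simp: vertex_coords_def split: prod.split)
  show "vertex_coords F1 F2 F3 ` T \<subseteq> ?R"
  proof (rule image_subsetI)
    fix t assume "t \<in> T"
    then show "vertex_coords F1 F2 F3 t \<in> ?R"
      using assms hom[of t] by (metis (mono_tags, lifting) mem_Collect_eq subsetD)
  qed
  show "?R \<subseteq> vertex_coords F1 F2 F3 ` T"
  proof
    fix g assume g: "g \<in> ?R"
    then have "vertex_coords F1 F2 F3 (triple_of_coords F1 F2 F3 g) = g"
      using homeomorphic_maps_vertex_coords[of F1 F2 F3]
      unfolding homeomorphic_maps_def by simp
    then show "g \<in> vertex_coords F1 F2 F3 ` T"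
      using g by (metis (mono_tags, lifting) image_eqI mem_Collect_eq)
  qed
qed

lemma normalized_subset_triple_space:
  "topspace (normalized_space F1 F2 F3) \<subseteq> topspace (triple_space F1 F2 F3)"
  unfolding normalized_space_def config_space_def topspace_subtopology by blast

text \<open>Each condition on a normalized triple cuts out an algebraic set of its own, and the image of
  the slice is their intersection.\<close>

lemma real_algebraic_set_normalized:
  assumes F: "free_linkage F1" "free_linkage F2" "free_linkage F3"
  shows "real_algebraic_set (coord_indices F1 F2 F3)
    (vertex_coords F1 F2 F3 ` topspace (normalized_space F1 F2 F3))"
proof -
  let ?V = "coord_indices F1 F2 F3"
  let ?E = "\<lambda>\<iota> d. {g \<in> ?V \<rightarrow>\<^sub>E UNIV.
    \<forall>i<length d. dist (vertex_at \<iota> g i) (vertex_at \<iota> g (Suc i)) = d ! i}"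
  let ?B = "\<lambda>\<iota> i p. {g \<in> ?V \<rightarrow>\<^sub>E UNIV. vertex_at \<iota> g i = p}"
  let ?Q = "\<lambda>\<iota> i \<kappa> j. {g \<in> ?V \<rightarrow>\<^sub>E UNIV. vertex_at \<iota> g i = vertex_at \<kappa> g j}"
  have len: "Suc 0 \<le> length F1" using F(1) by (simp add: free_linkage_def Suc_le_eq)
  have "vertex_coords F1 F2 F3 ` topspace (normalized_space F1 F2 F3) =
    {g \<in> ?V \<rightarrow>\<^sub>E UNIV. triple_of_coords F1 F2 F3 g \<in> config_triples F1 F2 F3 \<and>
       vertex_at Inl g 1 = vector [F1 ! 0, 0]}"
    using len
    by (subst vertex_coords_image[OF normalized_subset_triple_space])
      (simp add: topspace_normalized_space[OF F(1)], simp add: triple_of_coords_def)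
  also have "\<dots> = ?E Inl F1 \<inter> ?E (Inr \<circ> Inl) F2 \<inter> ?E (Inr \<circ> Inr) F3 \<inter>
      ?B Inl 0 0 \<inter> ?B (Inr \<circ> Inl) 0 0 \<inter> ?B (Inr \<circ> Inr) 0 0 \<inter>
      ?Q Inl (length F1) (Inr \<circ> Inl) (length F2) \<inter>
      ?Q (Inr \<circ> Inl) (length F2) (Inr \<circ> Inr) (length F3) \<inter>
      ?B Inl 1 (vector [F1 ! 0, 0])"
    unfolding triple_of_coords_in_config_triples_iff by blast
  also have "real_algebraic_set ?V \<dots>"
    using len
    by (intro real_algebraic_set_Int real_algebraic_set_edge_lengths real_algebraic_set_vertex_eq
        real_algebraic_set_vertex_eq_const F finite_coord_indices)
      (simp_all add: in_coord_indices)
  finally show ?thesis .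
qed

text \<open>The triangle inequality along the chain from the origin to the given vertex.\<close>

lemma norm_vertex_le_sum_list:
  assumes "free_linkage d" and "x \<in> configurations d" and "x 0 = 0" and "i \<in> vertices d"
  shows "norm (x i) \<le> sum_list d"
proof -
  have d: "d ! k > 0" "dist (x k) (x (Suc k)) = d ! k" if "k < length d" for k
    using assms(1,2) that by (auto simp: free_linkage_def configurations_def)
  have "norm (x i) \<le> (\<Sum>k<i. d ! k)"
    using assms(4)
  proof (induction i)
    case (Suc i)
    have "norm (x (Suc i)) \<le> norm (x i) + dist (x i) (x (Suc i))"
      by (metis dist_norm norm_minus_commute norm_triangle_sub)
    then show ?case using Suc d[of i] by simp
  qed (simp add: assms(3))
  also have "\<dots> \<le> (\<Sum>k<length d. d ! k)"
    using assms(4) d(1) by (intro sum_mono2) (auto intro: less_imp_le)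
  finally show ?thesis by (simp add: sum_list_sum_nth atLeast0LessThan)
qed

lemma homeomorphic_map_normalized:
  "homeomorphic_map (normalized_space F1 F2 F3)
    (subtopology (powertop_real (coord_indices F1 F2 F3))
      (vertex_coords F1 F2 F3 ` topspace (normalized_space F1 F2 F3)))
    (vertex_coords F1 F2 F3)"
proof -
  have hom: "homeomorphic_map (triple_space F1 F2 F3) (powertop_real (coord_indices F1 F2 F3))
      (vertex_coords F1 F2 F3)"
    using homeomorphic_maps_vertex_coords homeomorphic_map_maps by blast
  let ?N = "topspace (normalized_space F1 F2 F3)"
  have "vertex_coords F1 F2 F3 ` (topspace (triple_space F1 F2 F3) \<inter> ?N) =
      topspace (powertop_real (coord_indices F1 F2 F3)) \<inter> vertex_coords F1 F2 F3 ` ?N"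
    using normalized_subset_triple_space[of F1 F2 F3] homeomorphic_imp_surjective_map[OF hom]
    by blast
  from homeomorphic_map_subtopologies[OF hom this] show ?thesis
    by (simp add: normalized_space_eq[symmetric])
qed

lemma compact_Hausdorff_normalized_space:
  assumes F: "free_linkage F1" "free_linkage F2" "free_linkage F3"
  shows "compact_space (normalized_space F1 F2 F3)"
    and "Hausdorff_space (normalized_space F1 F2 F3)"
proof -
  let ?V = "coord_indices F1 F2 F3"
  let ?S = "vertex_coords F1 F2 F3 ` topspace (normalized_space F1 F2 F3)"
  have homeo: "normalized_space F1 F2 F3 homeomorphic_space subtopology (powertop_real ?V) ?S"
    using homeomorphic_map_normalized by (rule homeomorphic_map_imp_homeomorphic_space)
  have "compactin (powertop_real ?V) ?S"
  proof (rule compactin_real_algebraic_set[OF real_algebraic_set_normalized[OF F]])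
    fix g k
    assume "g \<in> ?S" and k: "k \<in> ?V"
    then obtain x y z where g: "g = vertex_coords F1 F2 F3 (x, y, z)"
      and t: "(x, y, z) \<in> config_triples F1 F2 F3"
      by (auto simp: topspace_normalized_space[OF F(1)])
    have le: "\<bar>p $ c\<bar> \<le> M" if "norm p \<le> M" for p :: "real^2" and c M
      using component_le_norm_cart[of p c] that by linarith
    from k show "\<bar>g k\<bar> \<le> max (sum_list F1) (max (sum_list F2) (sum_list F3))"
    proof (cases rule: coord_indices_cases)
      case (first i c)
      with t show ?thesis
        using norm_vertex_le_sum_list[OF F(1), of x i]
        by (auto simp: g vertex_coords_apply config_triples_def le_max_iff_disj intro!: le)
    next
      case (second i c)
      with t show ?thesis
        using norm_vertex_le_sum_list[OF F(2), of y i]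
        by (auto simp: g vertex_coords_apply config_triples_def le_max_iff_disj intro!: le)
    next
      case (third i c)
      with t show ?thesis
        using norm_vertex_le_sum_list[OF F(3), of z i]
        by (auto simp: g vertex_coords_apply config_triples_def le_max_iff_disj intro!: le)
    qed
  qed
  then show "compact_space (normalized_space F1 F2 F3)"
    using homeomorphic_compact_space[OF homeo] by (simp add: compactin_subspace)
  show "Hausdorff_space (normalized_space F1 F2 F3)"
    using homeomorphic_Hausdorff_space[OF homeo]
    by (simp add: Hausdorff_space_subtopology Hausdorff_space_product_topology)
qed

section \<open>Rotations acting on triples\<close>

lemma mat_1_in_SO2: "mat 1 \<in> SO2"
  by (simp add: SO2_def rotation_matrix_def orthogonal_matrix_id)

lemma SO2_mult: "A \<in> SO2 \<Longrightarrow> B \<in> SO2 \<Longrightarrow> A ** B \<in> SO2"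
  by (simp add: SO2_def rotation_matrix_def orthogonal_matrix_mul det_mul)

lemma SO2_transpose:
  assumes "A \<in> SO2"
  shows "transpose A \<in> SO2" and "transpose A ** A = mat 1"
  using assms by (auto simp: SO2_def rotation_matrix_def orthogonal_matrix_def)

lemma SO2_dist:
  assumes "A \<in> SO2"
  shows "dist (A *v p) (A *v q) = dist p q"
proof -
  have "orthogonal_transformation ((*v) A)"
    using assms by (simp add: SO2_def rotation_matrix_def orthogonal_transformation_matrix)
  then show ?thesis by (simp add: orthogonal_transformation_isometry)
qed

text \<open>The first column of \<open>A\<close> is the first unit vector; orthogonality of the columns and the
  determinant then determine the second one. Among orthogonal matrices the reflection in the
  axis would be a counterexample.\<close>

lemma SO2_fixing_positive_x_axis:
  assumes "A \<in> SO2" and "A *v vector [d, 0] = vector [d, 0]" and "d > 0"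
  shows "A = mat 1"
proof -
  have "A $ 1 $ 1 = 1" "A $ 2 $ 1 = 0"
    using assms(2,3) by (auto simp: vec_eq_iff forall_2 matrix_vector_mult_def sum_2)
  moreover have "A $ 1 $ 1 * A $ 1 $ 2 + A $ 2 $ 1 * A $ 2 $ 2 = 0"
    using SO2_transpose(2)[OF assms(1)]
    by (simp add: vec_eq_iff forall_2 matrix_matrix_mult_def sum_2 transpose_def mat_def)
  moreover have "A $ 1 $ 1 * A $ 2 $ 2 - A $ 1 $ 2 * A $ 2 $ 1 = 1"
    using assms(1) by (simp add: SO2_def rotation_matrix_def det_2)
  ultimately show ?thesis
    by (simp add: vec_eq_iff forall_2 mat_def)
qed

lemma rotate_triple_mult:
  "rotate_triple F1 F2 F3 A (rotate_triple F1 F2 F3 B t) = rotate_triple F1 F2 F3 (A ** B) t"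
  by (cases t) (auto simp: rotate_triple_def matrix_vector_mul_assoc)

lemma rotate_triple_mat_1:
  "t \<in> config_triples F1 F2 F3 \<Longrightarrow> rotate_triple F1 F2 F3 (mat 1) t = t"
  by (auto simp: rotate_triple_def config_triples_def configurations_def PiE_iff extensional_def
      fun_eq_iff)

lemma rotate_triple_in_config_triples:
  assumes "A \<in> SO2" and "t \<in> config_triples F1 F2 F3"
  shows "rotate_triple F1 F2 F3 A t \<in> config_triples F1 F2 F3"
  using assms
  by (auto simp: rotate_triple_def config_triples_def configurations_def SO2_dist)

text \<open>One inclusion is closure of the rotations under products; the other applies the inverse
  rotation, which is the transpose.\<close>

lemma SO2_orbit_rotate_triple:
  assumes "A \<in> SO2"
  shows "SO2_orbit F1 F2 F3 (rotate_triple F1 F2 F3 A t) = SO2_orbit F1 F2 F3 t"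
proof -
  have sub: "SO2_orbit F1 F2 F3 (rotate_triple F1 F2 F3 B s) \<subseteq> SO2_orbit F1 F2 F3 s"
    if "B \<in> SO2" for B s
    using that by (auto simp: SO2_orbit_def rotate_triple_mult SO2_mult)
  have "SO2_orbit F1 F2 F3 t \<subseteq> SO2_orbit F1 F2 F3 (rotate_triple F1 F2 F3 A t)"
  proof
    fix s assume "s \<in> SO2_orbit F1 F2 F3 t"
    then obtain B where B: "B \<in> SO2" "s = rotate_triple F1 F2 F3 B t"
      unfolding SO2_orbit_def by blast
    have "s = rotate_triple F1 F2 F3 (B ** transpose A) (rotate_triple F1 F2 F3 A t)"
      using SO2_transpose(2)[OF assms]
      by (simp add: B(2) rotate_triple_mult flip: matrix_mul_assoc)
    then show "s \<in> SO2_orbit F1 F2 F3 (rotate_triple F1 F2 F3 A t)"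
      unfolding SO2_orbit_def using B(1) assms by (auto intro: SO2_mult SO2_transpose)
  qed
  then show ?thesis using sub[OF assms] by blast
qed

text \<open>The rotation taking one triple to the other preserves the direction of the first edge, so it
  is the identity.\<close>

lemma normalized_triple_unique_in_orbit:
  assumes F1: "free_linkage F1"
    and s: "s \<in> topspace (normalized_space F1 F2 F3)"
    and t: "t \<in> topspace (normalized_space F1 F2 F3)"
    and orbit: "SO2_orbit F1 F2 F3 s = SO2_orbit F1 F2 F3 t"
  shows "s = t"
proof -
  have mem: "s \<in> config_triples F1 F2 F3" "t \<in> config_triples F1 F2 F3"
    and fst: "fst s 1 = vector [F1 ! 0, 0]" "fst t 1 = vector [F1 ! 0, 0]"
    using s t by (auto simp: topspace_normalized_space[OF F1])
  have "s \<in> SO2_orbit F1 F2 F3 s"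
    unfolding SO2_orbit_def using mat_1_in_SO2 rotate_triple_mat_1[OF mem(1)] by force
  then obtain A where A: "A \<in> SO2" "s = rotate_triple F1 F2 F3 A t"
    unfolding orbit by (auto simp: SO2_orbit_def)
  have "Suc 0 \<le> length F1" "F1 ! 0 > 0"
    using F1 by (auto simp: free_linkage_def Suc_le_eq)
  then have "A *v vector [F1 ! 0, 0] = vector [F1 ! 0, 0]"
    using A(2) fst by (cases t) (simp add: rotate_triple_def)
  then have "A = mat 1"
    using A(1) \<open>F1 ! 0 > 0\<close> by (intro SO2_fixing_positive_x_axis)
  then show ?thesis
    using A(2) rotate_triple_mat_1[OF mem(2)] by simp
qed

section \<open>Rotating the first edge onto the axis\<close>

text \<open>For a point \<open>p\<close> at distance \<open>d\<close> from the origin, this is the rotation by minus the argument of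
  \<open>p\<close>. The length is a separate argument rather than \<open>norm p\<close>, because for a fixed \<open>d\<close> the entries
  are linear in \<open>p\<close> and continuity needs no case distinction at the origin.\<close>

definition aligning_matrix :: "real \<Rightarrow> real^2 \<Rightarrow> real^2^2" where
  "aligning_matrix d p =
     vector [vector [p $ 1 / d, p $ 2 / d], vector [- p $ 2 / d, p $ 1 / d]]"

lemma aligning_matrix:
  assumes "norm p = d" and "d > 0"
  shows "aligning_matrix d p \<in> SO2" and "aligning_matrix d p *v p = vector [d, 0]"
proof -
  have d: "(p $ 1)\<^sup>2 + (p $ 2)\<^sup>2 = d\<^sup>2"
    using assms by (auto simp: norm_vec_def L2_set_def sum_2)
  then have one: "(p $ 1 / d)\<^sup>2 + (p $ 2 / d)\<^sup>2 = 1"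
    using assms(2) by (simp add: power_divide flip: add_divide_distrib)
  then show "aligning_matrix d p \<in> SO2"
    by (simp add: SO2_def rotation_matrix_def orthogonal_matrix det_2 aligning_matrix_def vec_eq_iff
        forall_2 matrix_matrix_mult_def sum_2 transpose_def mat_def power2_eq_square algebra_simps)
  show "aligning_matrix d p *v p = vector [d, 0]"
    using d assms(2)
    by (simp add: aligning_matrix_def vec_eq_iff forall_2 matrix_vector_mult_def sum_2
        power2_eq_square field_simps)
qed

definition normalize_triple :: "real list \<Rightarrow> real list \<Rightarrow> real list
    \<Rightarrow> config \<times> config \<times> config \<Rightarrow> config \<times> config \<times> config" where
  "normalize_triple F1 F2 F3 t =
     rotate_triple F1 F2 F3 (aligning_matrix (F1 ! 0) (fst t 1)) t"

lemma normalize_triple: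
  assumes F1: "free_linkage F1" and t: "t \<in> config_triples F1 F2 F3"
  shows "normalize_triple F1 F2 F3 t \<in> topspace (normalized_space F1 F2 F3)"
    and "SO2_orbit F1 F2 F3 (normalize_triple F1 F2 F3 t) = SO2_orbit F1 F2 F3 t"
proof -
  have "norm (fst t 1) = F1 ! 0" "F1 ! 0 > 0"
    using t norm_first_vertex[OF F1, of "fst t"] by (auto simp: config_triples_def)
  note A = aligning_matrix[OF this]
  have "Suc 0 \<le> length F1"
    using F1 by (auto simp: free_linkage_def Suc_le_eq)
  then have "fst (normalize_triple F1 F2 F3 t) 1 = vector [F1 ! 0, 0]"
    using A(2) by (cases t) (simp add: normalize_triple_def rotate_triple_def)
  then show "normalize_triple F1 F2 F3 t \<in> topspace (normalized_space F1 F2 F3)"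
    using rotate_triple_in_config_triples[OF A(1) t]
    by (simp add: topspace_normalized_space[OF F1] normalize_triple_def)
  show "SO2_orbit F1 F2 F3 (normalize_triple F1 F2 F3 t) = SO2_orbit F1 F2 F3 t"
    unfolding normalize_triple_def using A(1) by (rule SO2_orbit_rotate_triple)
qed

lemma continuous_map_aligning_matrix:
  assumes "continuous_map X euclidean p" and "continuous_map X euclidean f"
  shows "continuous_map X euclideanreal (\<lambda>t. (aligning_matrix d (p t) *v f t) $ c)"
proof -
  have comp: "continuous_map X euclideanreal (\<lambda>t. p t $ j)"
      "continuous_map X euclideanreal (\<lambda>t. f t $ j)" for j
    using assms by (auto simp: continuous_map_vec)
  have "continuous_map X euclideanreal (\<lambda>t. aligning_matrix d (p t) $ c $ j)" for j
    using exhaust_2[of c] exhaust_2[of j]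
    by (auto simp: aligning_matrix_def divide_inverse
        intro!: continuous_map_real_mult continuous_map_minus comp)
  then show ?thesis
    unfolding matrix_vector_mult_def
    by (simp add: sum_2 continuous_map_add continuous_map_real_mult comp)
qed

text \<open>The entries of the aligning matrix are linear in the first edge, so the coordinates of the
  normalized triple are polynomials in the original ones.\<close>

lemma continuous_map_normalize_triple:
  assumes F1: "free_linkage F1"
  shows "continuous_map (config_space F1 F2 F3) (normalized_space F1 F2 F3)
    (normalize_triple F1 F2 F3)"
proof -
  have one: "1 \<in> vertices F1"
    using F1 by (auto simp: free_linkage_def Suc_le_eq)
  have "continuous_map (triple_space F1 F2 F3) (triple_space F1 F2 F3)
      (normalize_triple F1 F2 F3)"
    unfolding normalize_triple_def rotate_triple_def case_prod_beta
      continuous_map_into_triple_space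
    by (intro conjI ballI allI continuous_map_aligning_matrix continuous_map_vertex one)
  then have "continuous_map (config_space F1 F2 F3) (triple_space F1 F2 F3)
      (normalize_triple F1 F2 F3)"
    unfolding config_space_def by (rule continuous_map_from_subtopology)
  then show ?thesis
    using normalize_triple(1)[OF F1]
    by (subst normalized_space_eq, intro continuous_map_into_subtopology)
      (simp_all add: topspace_config_space)
qed

text \<open>The inverse of the orbit map on the slice is the map that normalization induces on the
  quotient.\<close>

lemma homeomorphic_map_SO2_orbit:
  assumes F1: "free_linkage F1"
  shows "homeomorphic_map (normalized_space F1 F2 F3) (moduli_space F1 F2 F3)
    (SO2_orbit F1 F2 F3)"
proof -
  let ?C = "config_space F1 F2 F3" and ?N = "normalized_space F1 F2 F3"
  let ?M = "moduli_space F1 F2 F3"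
  let ?q = "SO2_orbit F1 F2 F3" and ?r = "normalize_triple F1 F2 F3"
  have q: "quotient_map ?C ?M ?q"
    unfolding moduli_space_def by (rule quotient_map_quotient_topology)
  \<comment> \<open>Both normalized triples lie on the same orbit and in the slice, hence they agree.\<close>
  have invariant: "?r s = ?r t"
    if "s \<in> topspace ?C" "t \<in> topspace ?C" "?q s = ?q t" for s t
    using that normalize_triple[OF F1] normalized_triple_unique_in_orbit[OF F1]
    by (metis topspace_config_space)
  obtain g where g: "continuous_map ?M ?N g" "\<And>t. t \<in> topspace ?C \<Longrightarrow> g (?q t) = ?r t"
    by (rule quotient_map_lift_exists[OF q continuous_map_normalize_triple[OF F1]])
      (use invariant in blast)+
  have NC: "topspace ?N \<subseteq> topspace ?C"
    by (auto simp: normalized_space_def)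
  have "homeomorphic_maps ?N ?M ?q g"
    unfolding homeomorphic_maps_def
  proof (intro conjI ballI)
    show "continuous_map ?N ?M ?q"
      unfolding normalized_space_def
      using quotient_imp_continuous_map[OF q] by (rule continuous_map_from_subtopology)
    show "continuous_map ?M ?N g" by (fact g(1))
  next
    fix t assume t: "t \<in> topspace ?N"
    then have C: "t \<in> config_triples F1 F2 F3"
      using NC by (auto simp: topspace_config_space)
    have "?r t = t"
      using normalize_triple[OF F1 C] t by (intro normalized_triple_unique_in_orbit[OF F1])
    then show "g (?q t) = t"
      using g(2) C by (simp add: topspace_config_space)
  next
    fix m assume "m \<in> topspace ?M"
    then obtain t where t: "t \<in> topspace ?C" "m = ?q t"
      using quotient_imp_surjective_map[OF q] by blast
    then show "?q (g m) = m"
      using g(2) normalize_triple(2)[OF F1] by (simp add: topspace_config_space)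
  qed
  then show ?thesis
    using homeomorphic_map_maps by blast
qed

theorem proposition2p2:
  fixes F1 F2 F3 :: "real list"
  assumes "free_linkage F1" and "free_linkage F2" and "free_linkage F3"
  shows "compact_space (moduli_space F1 F2 F3)
       \<and> Hausdorff_space (moduli_space F1 F2 F3)
       \<and> homeomorphic_map (normalized_space F1 F2 F3) (moduli_space F1 F2 F3)
           (SO2_orbit F1 F2 F3)
       \<and> real_algebraic_variety (coord_indices F1 F2 F3) (normalized_space F1 F2 F3)
           (vertex_coords F1 F2 F3)"
proof -
  have hom: "homeomorphic_map (normalized_space F1 F2 F3) (moduli_space F1 F2 F3)
      (SO2_orbit F1 F2 F3)"
    using assms(1) by (rule homeomorphic_map_SO2_orbit)
  then have "normalized_space F1 F2 F3 homeomorphic_space moduli_space F1 F2 F3"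
    by (rule homeomorphic_map_imp_homeomorphic_space)
  then have "compact_space (moduli_space F1 F2 F3)" "Hausdorff_space (moduli_space F1 F2 F3)"
    using compact_Hausdorff_normalized_space[OF assms]
      homeomorphic_compact_space homeomorphic_Hausdorff_space by blast+
  with hom show ?thesis
    unfolding real_algebraic_variety_def
    using real_algebraic_set_normalized[OF assms] homeomorphic_map_normalized by blast
qed

end
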